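(* Let $A\in\mathbb{R}^{n\times n}$ be unstable, $B\in\mathbb{R}^{n\times m}$, $K\in\mathbb{R}^{m\times n}$, and consider the closed-loop networked control system $$x(t+1)=Ax(t)+(1-l(t))BKx(t)+w(t),\quad t\in\mathbb{N}_0,\qquad x(0)=x_0,$$ with transmission failure indicator $l(t)=\mathbb{1}[r(t)\le p(\phi_{\mathrm J}(t))]$, where $p$, $r$, $\phi_{\mathrm J}$, $w$ and the concave upper bound $\hat p\ge p$ are as in the context. Let $\|\cdot\|$ be the matrix norm on $\mathbb{R}^{n\times n}$ induced by some vector norm on $\mathbb{R}^n$. Suppose that there exist scalars $\hat\kappa\ge0$ and $\hat\phi_{\mathrm J}\ge0$ such that $$\mathbb{P}\Big[\sum_{i=t_1}^{t_2-1}\phi_{\mathrm J}(i)\le\hat\kappa+\hat\phi_{\mathrm J}(t_2-t_1)\Big]=1\quad\text{for all }t_1,t_2\in\mathbb{N}_0\text{ with }t_1<t_2.$$ Furthermore, suppose that there exists $\overline w\ge0$ such that $\mathbb{P}[\|w(t)\|_2\le\overline w]=1$ for all $t\in\mathbb{N}_0$. If $$(1-\hat p(\hat\phi_{\mathrm J}))\|A+BK\|+\hat p(\hat\phi_{\mathrm J})\|A\|<1,$$ then there exist $\hat\mu\ge0$, $\hat\theta\in(0,1)$, and $\hat d\ge0$ such that, for every initial state $x_0\in\mathbb{R}^n$, $$\mathbb{E}[\|x(t)\|_2]\le\hat\mu\hat\theta^{t}\|x_0\|_2+\hat d\,\overline w,\quad t\in\mathbb{N}.$$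
   Context: $\mathbb{N}$ and $\mathbb{N}_0$ denote the positive and the nonnegative integers; $\|\cdot\|_2$ is the Euclidean norm. All random variables live on a probability space $(\Omega,\mathcal F,\mathbb P)$ with expectation $\mathbb E$. The induced matrix norm is $\|M\|=\sup_{x\neq0}\|Mx\|/\|x\|$. Unstable: $\sup_{t\in\mathbb{N}}\|A^t\|=\infty$; in particular $\|A\|>1$ for every induced matrix norm. Transmission failure model: $p\colon[0,\infty)\to[0,1]$ is a Borel-measurable nondecreasing function. $r(0),r(1),\ldots$ are independent random variables uniformly distributed in $[0,1]$. $\{\phi_{\mathrm J}(t)\in[0,\infty)\}_{t\in\mathbb{N}_0}$ is a stochastic process (the attacker's jamming interference power), and the processes $\{r(t)\}_{t\in\mathbb{N}_0}$ and $\{\phi_{\mathrm J}(t)\}_{t\in\mathbb{N}_0}$ are mutually independent. $l(t)=\mathbb{1}[r(t)\le p(\phi_{\mathrm J}(t))]\in\{0,1\}$, with $l(t)=1$ indicating a transmission failure. $\hat p\colon[0,\infty)\to[0,1]$ is a continuous, nondecreasing, concave function with $\hat p(\phi)\ge p(\phi)$ for all $\phi\in[0,\infty)$. The disturbance $\{w(t)\in\mathbb{R}^n\}_{t\in\mathbb{N}_0}$ is a stochastic process; it need not be independent of $\{l(t)\}$. The initial state $x_0\in\mathbb{R}^n$ is deterministic. *)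

theory Defs
  imports "HOL-Probability.Probability"
begin

definition is_norm :: "('a::real_vector \<Rightarrow> real) \<Rightarrow> bool" where
  "is_norm N \<longleftrightarrow>
     (\<forall>x. 0 \<le> N x) \<and> (\<forall>x. N x = 0 \<longleftrightarrow> x = 0) \<and>
     (\<forall>c x. N (c *\<^sub>R x) = \<bar>c\<bar> * N x) \<and> (\<forall>x y. N (x + y) \<le> N x + N y)"

definition induced_norm :: "(real ^ 'n \<Rightarrow> real) \<Rightarrow> real ^ 'n ^ 'n \<Rightarrow> real" where
  "induced_norm N A = (SUP x\<in>- {0}. N (A *v x) / N x)"

text \<open>The power operator of the type class on \<open>vec\<close> is componentwise, so the matrix power
  needs a function of its own.\<close>

primrec matrix_pow :: "real ^ 'n ^ 'n \<Rightarrow> nat \<Rightarrow> real ^ 'n ^ 'n" where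
  "matrix_pow A 0 = mat 1"
| "matrix_pow A (Suc t) = A ** matrix_pow A t"

text \<open>All norms on matrices of a fixed size are equivalent, so divergence of the supremum does
  not depend on the norm; the norm induced by the Euclidean norm is used.\<close>

definition unstable :: "real ^ 'n ^ 'n \<Rightarrow> bool" where
  "unstable A \<longleftrightarrow> (SUP t\<in>{1..}. ereal (induced_norm norm (matrix_pow A t))) = \<infinity>"

definition transmission_failure ::
  "(real \<Rightarrow> real) \<Rightarrow> (nat \<Rightarrow> 'a \<Rightarrow> real) \<Rightarrow> (nat \<Rightarrow> 'a \<Rightarrow> real) \<Rightarrow> nat \<Rightarrow> 'a \<Rightarrow> real" where
  "transmission_failure p r \<phi> t \<omega> = of_bool (r t \<omega> \<le> p (\<phi> t \<omega>))"

primrec closed_loop_state ::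
  "real ^ 'n ^ 'n \<Rightarrow> real ^ 'm ^ 'n \<Rightarrow> real ^ 'n ^ 'm \<Rightarrow> (nat \<Rightarrow> 'a \<Rightarrow> real) \<Rightarrow>
   (nat \<Rightarrow> 'a \<Rightarrow> real ^ 'n) \<Rightarrow> real ^ 'n \<Rightarrow> nat \<Rightarrow> 'a \<Rightarrow> real ^ 'n" where
  "closed_loop_state A B K l w x0 0 \<omega> = x0"
| "closed_loop_state A B K l w x0 (Suc t) \<omega> =
     A *v closed_loop_state A B K l w x0 t \<omega>
     + (1 - l t \<omega>) *\<^sub>R ((B ** K) *v closed_loop_state A B K l w x0 t \<omega>)
     + w t \<omega>"

end

(* Write a and b for the N-induced norms of A and A + BK; then b < 1 < a. Along every path N(x(t)) is
   at most the product of the gains g(i) = b + (a - b) l(i) times N(x0), plus a w_bar-multiple of the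
   sum of the products over the tails {s+1..t-1}. Conditioning on the jamming process replaces l(i) by
   p(phi(i)) in the expectation of such a product. The product of the b + (a - b) p_hat(phi(i)) over a
   window of length k is, by AM-GM and Jensen, at most
   (b + (a - b) p_hat(phi_hat + kappa_hat / k))^k, and by continuity of p_hat the base is eventually
   below a constant less than 1. *)
theory Submission
  imports Defs
begin

section \<open>Equivalence of norms on \<open>real ^ 'n\<close> and the induced matrix norms\<close>

lemma is_norm_le_norm:
  fixes N :: "real ^ 'n \<Rightarrow> real"
  assumes "is_norm N"
  shows "N x \<le> (\<Sum>i\<in>UNIV. N (axis i 1)) * norm x"
proof -
  have N: "\<And>x. 0 \<le> N x" "\<And>c x. N (c *\<^sub>R x) = \<bar>c\<bar> * N x" "\<And>x y. N (x + y) \<le> N x + N y" "N 0 = 0"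
    using assms by (auto simp: is_norm_def)
  have sum_le: "N (\<Sum>i\<in>I. f i) \<le> (\<Sum>i\<in>I. N (f i))" if "finite I" for I :: "'n set" and f
    using that by (induction I) (auto simp: N(4) intro: order_trans[OF N(3)])
  have "x = (\<Sum>i\<in>UNIV. (x $ i) *\<^sub>R axis i 1)"
    using basis_expansion[of x] by (simp add: scalar_mult_eq_scaleR)
  then have "N x \<le> (\<Sum>i\<in>UNIV. \<bar>x $ i\<bar> * N (axis i 1))"
    using sum_le[of UNIV "\<lambda>i. (x $ i) *\<^sub>R axis i 1"] by (simp add: N(2))
  also have "\<dots> \<le> (\<Sum>i\<in>UNIV. norm x * N (axis i 1))"
    by (intro sum_mono mult_right_mono component_le_norm_cart N)
  finally show ?thesis by (simp add: sum_distrib_left mult.commute)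
qed

text \<open>The upper constant comes from the expansion in the standard basis. The lower one is the
  minimum of \<open>N\<close> on the Euclidean unit sphere, attained by compactness and positive by
  definiteness.\<close>

lemma is_norm_equivalent:
  fixes N :: "real ^ 'n \<Rightarrow> real"
  assumes "is_norm N"
  obtains c C where "0 < c" "0 < C" "\<And>x. c * norm x \<le> N x" "\<And>x. N x \<le> C * norm x"
proof -
  have N: "\<And>x. 0 \<le> N x" "\<And>c x. N (c *\<^sub>R x) = \<bar>c\<bar> * N x" "\<And>x y. N (x + y) \<le> N x + N y" "\<And>x. N x = 0 \<longleftrightarrow> x = 0"
    using assms by (auto simp: is_norm_def)
  \<comment> \<open>The summand 1 makes \<open>C\<close> positive at once.\<close>
  define C where "C = (\<Sum>i\<in>UNIV. N (axis i 1)) + 1"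
  have "0 \<le> (\<Sum>i\<in>UNIV. N (axis i 1))"
    by (intro sum_nonneg N)
  then have "0 < C" by (simp add: C_def)
  have upper: "N x \<le> C * norm x" for x
    using is_norm_le_norm[OF assms, of x] by (auto simp: C_def distrib_right intro: order_trans)
  \<comment> \<open>The reverse triangle inequality and the upper bound make \<open>N\<close>
    Lipschitz for the Euclidean metric, hence continuous on the sphere.\<close>
  have "N x - N y \<le> N (x - y)" for x y
    using N(3)[of "x - y" y] by simp
  moreover have "N (y - x) = N (x - y)" for x y
    using N(2)[of "-1" "x - y"] by simp
  ultimately have "\<bar>N x - N y\<bar> \<le> C * norm (x - y)" for x y
    using upper[of "x - y"] by (metis abs_le_iff minus_diff_eq order_trans)
  then have "C-lipschitz_on UNIV N"
    using \<open>0 < C\<close> by (auto simp: lipschitz_on_def dist_norm)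
  then have "continuous_on (sphere 0 1) N"
    using lipschitz_on_continuous_on continuous_on_subset by blast
  moreover have "sphere (0 :: real ^ 'n) 1 \<noteq> {}" by simp
  ultimately obtain z where z: "z \<in> sphere 0 1" "\<And>y. y \<in> sphere 0 1 \<Longrightarrow> N z \<le> N y"
    using continuous_attains_inf[OF compact_sphere] by metis
  then have "0 < N z" using N(1,4)[of z] by force
  moreover have "N z * norm x \<le> N x" for x
  proof (cases "x = 0")
    case False
    then have "N z \<le> N ((1 / norm x) *\<^sub>R x)"
      by (intro z) simp
    with False show ?thesis by (simp add: N(2) field_simps)
  qed (simp add: N)
  ultimately show thesis using that \<open>0 < C\<close> upper by blast
qed

text \<open>A real-valued \<open>SUP\<close> bounds its members only if they are bounded above.
  Boundedness of the quotients follows from the equivalence of \<open>N\<close> with the Euclidean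
  norm and the boundedness of the linear map.\<close>

lemma induced_norm:
  fixes N :: "real ^ 'n \<Rightarrow> real"
  assumes "is_norm N"
  shows induced_norm_bound: "N (A *v x) \<le> induced_norm N A * N x"
    and induced_norm_nonneg: "0 \<le> induced_norm N A"
proof -
  have N: "\<And>x. 0 \<le> N x" "\<And>x. N x = 0 \<longleftrightarrow> x = 0"
    using assms by (auto simp: is_norm_def)
  obtain c C where cC: "0 < c" "0 < C" "\<And>x. c * norm x \<le> N x" "\<And>x. N x \<le> C * norm x"
    using is_norm_equivalent[OF assms] by blast
  obtain D where D: "0 < D" "\<And>x. norm (A *v x) \<le> norm x * D"
    using bounded_linear.pos_bounded[OF matrix_vector_mul_bounded_linear] by metis
  have "N (A *v x) / N x \<le> C * D / c" if "x \<noteq> 0" for x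
  proof -
    have "N (A *v x) \<le> C * (norm x * D)"
      using cC(4)[of "A *v x"] D(2)[of x] cC(2) by (meson mult_left_mono order_less_imp_le order_trans)
    also have "\<dots> \<le> C * (N x / c * D)"
      using cC D by (intro mult_left_mono mult_right_mono) (auto simp: field_simps)
    finally show ?thesis using N[of x] that cC(1) by (auto simp: field_simps)
  qed
  then have bdd: "bdd_above ((\<lambda>x. N (A *v x) / N x) ` (- {0}))"
    by (auto intro!: bdd_aboveI[where M="C * D / c"])
  have le: "N (A *v x) / N x \<le> induced_norm N A" if "x \<noteq> 0" for x
    unfolding induced_norm_def using that by (intro cSUP_upper bdd) auto
  show "N (A *v x) \<le> induced_norm N A * N x"
    using le[of x] N(1)[of x] N(2)[of x] N(2)[of "A *v x"]
    by (cases "x = 0") (auto simp: field_simps)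
  \<comment> \<open>The supremum ranges over a nonempty set, so it is at least the nonnegative
    quotient at this unit vector.\<close>
  have "axis undefined 1 \<noteq> (0 :: real ^ 'n)" by (simp add: axis_eq_0_iff)
  from le[OF this] show "0 \<le> induced_norm N A"
    using N(1) by (meson divide_nonneg_nonneg order_trans)
qed

text \<open>Otherwise all powers of \<open>A\<close> would be nonexpansive for \<open>N\<close>, and
  their Euclidean operator norms would stay below \<open>C / c\<close>, against instability.\<close>

lemma unstable_imp_induced_norm_gt_1:
  fixes N :: "real ^ 'n \<Rightarrow> real"
  assumes "is_norm N" "unstable A"
  shows "1 < induced_norm N A"
proof (rule ccontr)
  assume le1: "\<not> 1 < induced_norm N A"
  obtain c C where cC: "0 < c" "0 < C" "\<And>x. c * norm x \<le> N x" "\<And>x. N x \<le> C * norm x"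
    using is_norm_equivalent[OF assms(1)] by blast
  have N: "\<And>x. 0 \<le> N x"
    using assms by (auto simp: is_norm_def)
  have pow: "N (matrix_pow A t *v x) \<le> N x" for t x
  proof (induction t)
    case (Suc t)
    have "N (A *v (matrix_pow A t *v x)) \<le> 1 * N (matrix_pow A t *v x)"
      using le1 by (intro order_trans[OF induced_norm_bound[OF assms(1)]] mult_right_mono N) auto
    with Suc show ?case by (simp add: matrix_vector_mul_assoc)
  qed simp
  have "axis undefined 1 \<noteq> (0 :: real ^ 'n)" by (simp add: axis_eq_0_iff)
  then have ne: "- {0 :: real ^ 'n} \<noteq> {}" by auto
  have "norm (matrix_pow A t *v x) / norm x \<le> C / c" if "x \<noteq> 0" for t x
    using order_trans[OF cC(3)[of "matrix_pow A t *v x"] order_trans[OF pow cC(4)]] cC(1) that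
    by (simp add: field_simps)
  then have "induced_norm norm (matrix_pow A t) \<le> C / c" for t
    unfolding induced_norm_def by (intro cSUP_least ne) auto
  then have "(SUP t\<in>{1..}. ereal (induced_norm norm (matrix_pow A t))) \<le> ereal (C / c)"
    by (intro SUP_least) simp
  with assms(2) show False by (simp add: unstable_def)
qed

section \<open>Geometric decay of products under a budget on the arguments\<close>

lemma prod_le_mean_power:
  fixes f :: "'i \<Rightarrow> real"
  assumes "finite I" "\<And>i. i \<in> I \<Longrightarrow> 0 \<le> f i"
  shows "(\<Prod>i\<in>I. f i) \<le> ((\<Sum>i\<in>I. f i) / card I) ^ card I"
proof (cases "I = {}")
  case False
  define k where "k = card I"
  have k: "k > 0" using False assms(1) by (simp add: k_def card_gt_0_iff)
  have P: "0 \<le> (\<Prod>i\<in>I. f i)" by (intro prod_nonneg assms)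
  \<comment> \<open>This introduces the geometric mean; if the product is 0, both sides vanish
    because \<open>k > 0\<close>.\<close>
  have "(\<Prod>i\<in>I. f i) = ((\<Prod>i\<in>I. f i) powr (1 / k)) ^ k"
    using P k by (cases "(\<Prod>i\<in>I. f i) = 0") (simp_all add: powr_power del: prod_zero_iff)
  also have "\<dots> \<le> ((\<Sum>i\<in>I. f i) / k) ^ k"
    using arith_geom_mean[OF assms(1) False assms(2)]
    by (intro power_mono) (simp_all add: k_def sum_divide_distrib)
  finally show ?thesis by (simp add: k_def)
qed simp

text \<open>\<open>D\<close> and \<theta> are uniform in \<open>I\<close> and \<open>x\<close>. The
  mean of \<open>x\<close> over \<open>I\<close> is at most \<phi> + \<kappa> /
  \<open>card I\<close>, which is close to \<phi> for large \<open>I\<close>; \<open>D\<close> pays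
  for the small sets, where \<kappa> still dominates.\<close>

lemma prod_concave_le_geometric:
  fixes q :: "real \<Rightarrow> real"
  assumes cont: "continuous_on {0..} q" and mono: "mono_on {0..} q" and conc: "concave_on {0..} q"
    and range: "q ` {0..} \<subseteq> {0..1}"
    and "0 \<le> \<kappa>" "0 \<le> \<phi>" "0 \<le> b" "b \<le> a" "b + (a - b) * q \<phi> < 1"
  obtains D \<theta> where "0 \<le> D" "0 < \<theta>" "\<theta> < 1"
    "\<And>(I :: 'i set) x. finite I \<Longrightarrow> (\<And>i. i \<in> I \<Longrightarrow> 0 \<le> x i) \<Longrightarrow>
       (\<Sum>i\<in>I. x i) \<le> \<kappa> + \<phi> * real (card I) \<Longrightarrow>
       (\<Prod>i\<in>I. b + (a - b) * q (x i)) \<le> D * \<theta> ^ card I"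
proof -
  define h where "h y = b + (a - b) * q y" for y
  have h_nonneg: "0 \<le> h y" if "0 \<le> y" for y
    using range that assms by (auto simp: h_def)
  have "h \<phi> < 1" using assms by (simp only: h_def)
  \<comment> \<open>The midpoint of \<open>h \<phi>\<close> and 1 leaves room on both sides and is
    positive because \<open>h \<phi>\<close> is nonnegative.\<close>
  define \<theta> where "\<theta> = (h \<phi> + 1) / 2"
  have \<theta>: "0 < \<theta>" "\<theta> < 1" "h \<phi> < \<theta>"
    using h_nonneg[of \<phi>] assms(6) \<open>h \<phi> < 1\<close> by (auto simp: \<theta>_def)
  have "(\<lambda>k. \<phi> + \<kappa> / real k) \<longlonglongrightarrow> \<phi> + 0"
    by (intro tendsto_intros lim_const_over_n)
  then have "(\<lambda>k. q (\<phi> + \<kappa> / real k)) \<longlonglongrightarrow> q \<phi>"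
    using assms by (intro continuous_on_tendsto_compose[OF cont]) auto
  then have "(\<lambda>k. h (\<phi> + \<kappa> / real k)) \<longlonglongrightarrow> h \<phi>"
    unfolding h_def by (intro tendsto_intros)
  then have "\<forall>\<^sub>F k in sequentially. h (\<phi> + \<kappa> / real k) < \<theta>"
    using \<theta>(3) by (rule order_tendstoD)
  then obtain k0 where k0: "\<And>k. k \<ge> k0 \<Longrightarrow> h (\<phi> + \<kappa> / real k) < \<theta>"
    by (auto simp: eventually_sequentially)
  \<comment> \<open>A set of at most \<open>k0\<close> elements has a product of at most
    \<open>max 1 a ^ card I\<close>. Since \<open>max 1 a / \<theta>\<close> exceeds 1, the exponent
    in \<open>(max 1 a / \<theta>) ^ card I\<close> may be raised to \<open>k0\<close>.\<close>
  define D where "D = (max 1 a / \<theta>) ^ k0"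
  have D: "1 \<le> D" using \<theta> unfolding D_def by (intro one_le_power) (simp add: field_simps)
  have "(\<Prod>i\<in>I. h (x i)) \<le> D * \<theta> ^ card I"
    if I: "finite I" and x: "\<And>i. i \<in> I \<Longrightarrow> 0 \<le> x i"
      and sum: "(\<Sum>i\<in>I. x i) \<le> \<kappa> + \<phi> * real (card I)" for I :: "'i set" and x
  \<comment> \<open>The 1 sends the empty set to the second case, since Jensen needs a nonempty
    index set; that case still has \<open>card I \<le> k0\<close>.\<close>
  proof (cases "card I \<ge> max 1 k0")
    case True
    then have ne: "I \<noteq> {}" and k: "card I > 0" by auto
    have "(\<Sum>i\<in>I. h (x i)) / card I = b + (a - b) * (\<Sum>i\<in>I. 1 / card I * q (x i))"
      using k by (simp add: h_def sum.distrib flip: sum_distrib_left sum_divide_distrib)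
        (simp add: add_divide_distrib)
    \<comment> \<open>Jensen's inequality with equal weights; \<open>a - b\<close> is nonnegative,
      so the direction is kept.\<close>
    also have "\<dots> \<le> b + (a - b) * q (\<Sum>i\<in>I. (1 / card I) *\<^sub>R x i)"
      using assms x k by (intro add_mono mult_left_mono concave_on_sum[OF I ne conc]) auto
    also have "(\<Sum>i\<in>I. (1 / card I) *\<^sub>R x i) = (\<Sum>i\<in>I. x i) / card I"
      by (simp add: sum_divide_distrib)
    also have "b + (a - b) * q ((\<Sum>i\<in>I. x i) / card I) \<le> h (\<phi> + \<kappa> / card I)"
      unfolding h_def using assms sum k x
      by (intro add_mono mult_left_mono mono_onD[OF mono]) (auto simp: field_simps intro!: sum_nonneg)
    finally have le: "(\<Sum>i\<in>I. h (x i)) / card I \<le> \<theta>"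
      using k0[of "card I"] True by simp
    have "(\<Prod>i\<in>I. h (x i)) \<le> ((\<Sum>i\<in>I. h (x i)) / card I) ^ card I"
      using I x h_nonneg by (intro prod_le_mean_power) auto
    also have "\<dots> \<le> \<theta> ^ card I"
      using le x h_nonneg by (intro power_mono divide_nonneg_nonneg sum_nonneg) auto
    also have "\<dots> \<le> D * \<theta> ^ card I" using D \<theta> by simp
    finally show ?thesis .
  next
    case False
    have "h y \<le> max 1 a" if "0 \<le> y" for y
    proof -
      have "(a - b) * q y \<le> (a - b) * 1"
        using range that assms by (intro mult_left_mono) auto
      then show ?thesis by (simp add: h_def)
    qed
    then have "(\<Prod>i\<in>I. h (x i)) \<le> (\<Prod>i\<in>I. max 1 a)"
      using x h_nonneg by (intro prod_mono) auto
    also have "\<dots> = (max 1 a / \<theta>) ^ card I * \<theta> ^ card I"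
      using \<theta> by (simp add: power_divide)
    also have "\<dots> \<le> D * \<theta> ^ card I"
      unfolding D_def using \<theta> False by (intro mult_right_mono power_increasing) (auto simp: field_simps)
    finally show ?thesis .
  qed
  then show thesis using that[of D \<theta>] D \<theta> by (simp add: h_def)
qed

section \<open>Averaging over the uniform variables \<open>r\<close>\<close>

lemma (in prob_space) prob_uniform_le:
  assumes [measurable]: "X \<in> borel_measurable M"
    and "distr M borel X = uniform_measure lborel {0..1}" "0 \<le> c" "c \<le> (1 :: real)"
  shows "prob {\<omega>\<in>space M. X \<omega> \<le> c} = c"
proof -
  have "prob {\<omega>\<in>space M. X \<omega> \<le> c} = measure (distr M borel X) {..c}"
    by (subst measure_distr) (auto intro!: arg_cong[where f=prob])
  also have "\<dots> = measure lborel ({0..1} \<inter> {..c}) / measure lborel {0..1::real}"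
    unfolding assms(2) by (subst measure_uniform_measure) auto
  also have "{0..1} \<inter> {..c} = {0..c}" using assms by auto
  finally show ?thesis using assms by simp
qed

text \<open>Independence of the two processes makes their joint law a product, so Fubini allows the
  path of \<phi> to be frozen. For a frozen path the factors are independent, and each indicator
  averages to its threshold.\<close>

lemma (in prob_space) expectation_prod_of_bool_le:
  fixes r \<phi> :: "'i::countable \<Rightarrow> 'a \<Rightarrow> real" and q :: "real \<Rightarrow> real" and b c :: real
  assumes r[measurable]: "\<And>i. r i \<in> borel_measurable M"
    and uniform: "\<And>i. distr M borel (r i) = uniform_measure lborel {0..1}"
    and indep: "indep_vars (\<lambda>_. borel) r UNIV"
    and \<phi>[measurable]: "\<And>i. \<phi> i \<in> borel_measurable M"
    and indep2: "indep_var (\<Pi>\<^sub>M i\<in>UNIV. borel) (\<lambda>\<omega> i. r i \<omega>) (\<Pi>\<^sub>M i\<in>UNIV. borel) (\<lambda>\<omega> i. \<phi> i \<omega>)"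
    and q[measurable]: "q \<in> borel_measurable borel"
    and q01: "\<And>x. 0 \<le> q x" "\<And>x. q x \<le> 1"
    and I: "finite I"
  shows "expectation (\<lambda>\<omega>. \<Prod>i\<in>I. b + c * of_bool (r i \<omega> \<le> q (\<phi> i \<omega>)))
       = expectation (\<lambda>\<omega>. \<Prod>i\<in>I. b + c * q (\<phi> i \<omega>))"
proof -
  let ?S = "\<Pi>\<^sub>M i\<in>(UNIV :: 'i set). (borel :: real measure)"
  let ?R = "distr M ?S (\<lambda>\<omega> i. r i \<omega>)" and ?F = "distr M ?S (\<lambda>\<omega> i. \<phi> i \<omega>)"
  have [measurable]: "(\<lambda>\<omega> i. r i \<omega>) \<in> M \<rightarrow>\<^sub>M ?S" "(\<lambda>\<omega> i. \<phi> i \<omega>) \<in> M \<rightarrow>\<^sub>M ?S"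
    using indep_var_rv1[OF indep2] indep_var_rv2[OF indep2] .
  have joint: "?R \<Otimes>\<^sub>M ?F = distr M (?S \<Otimes>\<^sub>M ?S) (\<lambda>\<omega>. (\<lambda>i. r i \<omega>, \<lambda>i. \<phi> i \<omega>))"
    using indep2 by (simp add: indep_var_distribution_eq)
  interpret R: prob_space ?R by (rule prob_space_distr) measurable
  interpret F: prob_space ?F by (rule prob_space_distr) measurable
  interpret RF: pair_prob_space ?R ?F ..
  define G where "G \<rho> f = (\<Prod>i\<in>I. b + c * of_bool (\<rho> i \<le> q (f i)))" for \<rho> f :: "'i \<Rightarrow> real"
  have [measurable]: "case_prod G \<in> borel_measurable (?S \<Otimes>\<^sub>M ?S)"
    unfolding G_def of_bool_def by measurable
  \<comment> \<open>A finite product of bounded factors is bounded, which gives the integrability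
    that Fubini requires.\<close>
  have "\<bar>G \<rho> f\<bar> \<le> (\<Prod>i\<in>I. \<bar>b\<bar> + \<bar>c\<bar>)" for \<rho> f
    unfolding G_def abs_prod by (intro prod_mono) (auto simp: of_bool_def)
  then have int: "integrable (?R \<Otimes>\<^sub>M ?F) (case_prod G)"
    by (intro RF.integrable_const_bound[where B="\<Prod>i\<in>I. \<bar>b\<bar> + \<bar>c\<bar>"]) auto
  \<comment> \<open>Here \<open>f\<close> is a fixed path of \<phi>, so the i-th factor depends only
    on \<open>r i\<close> and the expectation factorises.\<close>
  have fixed: "(\<integral>\<rho>. G \<rho> f \<partial>?R) = (\<Prod>i\<in>I. b + c * q (f i))" for f
  proof -
    define Y where "Y i \<rho> = b + c * of_bool (\<rho> \<le> q (f i))" for i and \<rho> :: real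
    have [measurable]: "Y i \<in> borel_measurable borel" for i
      unfolding Y_def of_bool_def by measurable
    have [measurable]: "(\<lambda>\<rho>. G \<rho> f) \<in> borel_measurable ?S"
      unfolding G_def of_bool_def by measurable
    have [simp]: "integrable M (\<lambda>\<omega>. Y i (r i \<omega>))" for i
      by (intro integrable_const_bound[where B="\<bar>b\<bar> + \<bar>c\<bar>"]) (auto simp: Y_def)
    have "(\<integral>\<rho>. G \<rho> f \<partial>?R) = expectation (\<lambda>\<omega>. \<Prod>i\<in>I. Y i (r i \<omega>))"
      by (subst integral_distr) (simp_all add: G_def Y_def)
    also have "\<dots> = (\<Prod>i\<in>I. expectation (\<lambda>\<omega>. Y i (r i \<omega>)))"
      by (intro indep_vars_lebesgue_integral I indep_vars_compose2[OF indep_vars_subset[OF indep]]) auto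
    also have "\<dots> = (\<Prod>i\<in>I. b + c * q (f i))"
    proof (rule prod.cong)
      fix i
      have "expectation (\<lambda>\<omega>. Y i (r i \<omega>))
          = expectation (\<lambda>\<omega>. b + c * indicator {\<omega>\<in>space M. r i \<omega> \<le> q (f i)} \<omega>)"
        by (intro Bochner_Integration.integral_cong) (auto simp: Y_def)
      also have "\<dots> = b + c * q (f i)"
        using prob_uniform_le[OF r uniform q01, of i "f i"]
        by (subst Bochner_Integration.integral_add) (simp_all add: prob_space less_top[symmetric])
      finally show "expectation (\<lambda>\<omega>. Y i (r i \<omega>)) = b + c * q (f i)" .
    qed simp
    finally show ?thesis .
  qed
  have "expectation (\<lambda>\<omega>. G (\<lambda>i. r i \<omega>) (\<lambda>i. \<phi> i \<omega>)) = integral\<^sup>L (?R \<Otimes>\<^sub>M ?F) (case_prod G)"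
    unfolding joint by (subst integral_distr) simp_all
  \<comment> \<open>Fubini with the integral over \<open>r\<close> innermost, as
    \<open>fixed\<close> needs.\<close>
  also have "\<dots> = (\<integral>f. (\<integral>\<rho>. G \<rho> f \<partial>?R) \<partial>?F)"
    using RF.integral_snd[OF int] by simp
  also have "\<dots> = expectation (\<lambda>\<omega>. \<Prod>i\<in>I. b + c * q (\<phi> i \<omega>))"
    unfolding fixed by (subst integral_distr) simp_all
  finally show ?thesis by (simp add: G_def)
qed

section \<open>Pathwise growth and measurability of the closed-loop state\<close>

lemma closed_loop_state_norm_le:
  fixes A :: "real ^ 'n ^ 'n"
  assumes N: "is_norm N" and l: "\<And>t. l t \<omega> \<in> {0, 1}"
    and W: "\<And>t. N (w t \<omega>) \<le> W"
    and a: "induced_norm N A = a" and b: "induced_norm N (A + B ** K) = b"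
  shows "N (closed_loop_state A B K l w x0 t \<omega>)
    \<le> (\<Prod>i=0..<t. b + (a - b) * l i \<omega>) * N x0
      + W * (\<Sum>s<t. \<Prod>i=Suc s..<t. b + (a - b) * l i \<omega>)"
proof (induction t)
  case (Suc t)
  let ?x = "closed_loop_state A B K l w x0 t \<omega>" and ?g = "\<lambda>i. b + (a - b) * l i \<omega>"
  have ab: "0 \<le> a" "0 \<le> b" using induced_norm_nonneg[OF N] a b by auto
  have g: "0 \<le> ?g t" using l[of t] ab by auto
  \<comment> \<open>A failure leaves \<open>A\<close> acting alone, with gain \<open>a\<close>; a
    success makes \<open>A + B ** K\<close> act, with gain \<open>b\<close>.\<close>
  have "N (A *v ?x + (1 - l t \<omega>) *\<^sub>R ((B ** K) *v ?x)) \<le> ?g t * N ?x"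
    using l[of t] induced_norm_bound[OF N, of A ?x] induced_norm_bound[OF N, of "A + B ** K" ?x] a b
    by (auto simp: matrix_vector_mult_add_rdistrib)
  moreover have "N (y + z) \<le> N y + N z" for y z
    using N by (simp add: is_norm_def)
  ultimately have "N (closed_loop_state A B K l w x0 (Suc t) \<omega>) \<le> ?g t * N ?x + W"
    using W[of t] by (auto intro: order_trans[OF _ add_mono])
  also have "\<dots> \<le> ?g t * ((\<Prod>i=0..<t. ?g i) * N x0 + W * (\<Sum>s<t. \<Prod>i=Suc s..<t. ?g i)) + W"
    using mult_left_mono[OF Suc g] by simp
  \<comment> \<open>The bare \<open>W\<close> is the new summand \<open>s = t\<close> with its empty
    product: a disturbance at time \<open>s\<close> enters after gain \<open>s\<close> has acted, so
    only gains from \<open>Suc s\<close> on amplify it.\<close>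
  also have "\<dots> = (\<Prod>i=0..<Suc t. ?g i) * N x0 + W * (\<Sum>s<Suc t. \<Prod>i=Suc s..<Suc t. ?g i)"
    by (simp add: sum_distrib_left algebra_simps)
  finally show ?case .
qed simp

lemma closed_loop_state_measurable:
  fixes A :: "real ^ 'n ^ 'n"
  assumes [measurable]: "\<And>t. l t \<in> borel_measurable M" "\<And>t. w t \<in> borel_measurable M"
  shows "closed_loop_state A B K l w x0 t \<in> borel_measurable M"
proof (induction t)
  case (Suc t)
  note [measurable] = Suc
  have lin: "(\<lambda>x. C *v x) \<in> borel_measurable borel" for C :: "real ^ 'n ^ 'n"
    by (intro borel_measurable_continuous_onI linear_continuous_on matrix_vector_mul_bounded_linear)
  have [measurable]: "(\<lambda>\<omega>. C *v closed_loop_state A B K l w x0 t \<omega>) \<in> borel_measurable M"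
    for C :: "real ^ 'n ^ 'n"
    using measurable_compose[OF Suc lin] .
  have "closed_loop_state A B K l w x0 (Suc t) = (\<lambda>\<omega>. A *v closed_loop_state A B K l w x0 t \<omega>
     + (1 - l t \<omega>) *\<^sub>R ((B ** K) *v closed_loop_state A B K l w x0 t \<omega>) + w t \<omega>)"
    by (simp add: fun_eq_iff)
  then show ?case by simp
next
  case 0
  have "closed_loop_state A B K l w x0 0 = (\<lambda>_. x0)" by (simp add: fun_eq_iff)
  then show ?case by simp
qed

section \<open>The exponential bound on the expected state norm\<close>

theorem mainTheorem1:
  fixes M :: "'a measure"
    and A :: "real ^ 'n ^ 'n" and B :: "real ^ 'm ^ 'n" and K :: "real ^ 'n ^ 'm"
    and N :: "real ^ 'n \<Rightarrow> real"
    and p p_hat :: "real \<Rightarrow> real"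
    and r \<phi>J :: "nat \<Rightarrow> 'a \<Rightarrow> real"
    and w :: "nat \<Rightarrow> 'a \<Rightarrow> real ^ 'n"
    and \<kappa>_hat \<phi>_hat w_bar :: real
  assumes "prob_space M"
    and "unstable A"
    and "is_norm N"
    and "p \<in> borel_measurable (restrict_space borel {0..})"
    and "mono_on {0..} p"
    and "p ` {0..} \<subseteq> {0..1}"
    and "continuous_on {0..} p_hat"
    and "mono_on {0..} p_hat"
    and "concave_on {0..} p_hat"
    and "p_hat ` {0..} \<subseteq> {0..1}"
    and "\<And>\<phi>. 0 \<le> \<phi> \<Longrightarrow> p \<phi> \<le> p_hat \<phi>"
    and "\<And>t. r t \<in> borel_measurable M"
    and "\<And>t. distr M borel (r t) = uniform_measure lborel {0..1}"
    and "prob_space.indep_vars M (\<lambda>_. borel) r UNIV"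
    and "\<And>t. \<phi>J t \<in> borel_measurable M"
    and "\<And>t \<omega>. \<omega> \<in> space M \<Longrightarrow> 0 \<le> \<phi>J t \<omega>"
    and "prob_space.indep_var M
           (\<Pi>\<^sub>M t\<in>UNIV. borel) (\<lambda>\<omega> t. r t \<omega>)
           (\<Pi>\<^sub>M t\<in>UNIV. borel) (\<lambda>\<omega> t. \<phi>J t \<omega>)"
    and "\<And>t. w t \<in> borel_measurable M"
    and "0 \<le> \<kappa>_hat" and "0 \<le> \<phi>_hat"
    and "\<And>t1 t2. t1 < t2 \<Longrightarrow>
           \<P>(\<omega> in M. (\<Sum>i=t1..<t2. \<phi>J i \<omega>) \<le> \<kappa>_hat + \<phi>_hat * real (t2 - t1)) = 1"
    and "0 \<le> w_bar"
    and "\<And>t. \<P>(\<omega> in M. norm (w t \<omega>) \<le> w_bar) = 1"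
    and "(1 - p_hat \<phi>_hat) * induced_norm N (A + B ** K) + p_hat \<phi>_hat * induced_norm N A < 1"
  shows "\<exists>\<mu>\<ge>0. \<exists>\<theta>\<in>{0<..<1}. \<exists>d\<ge>0. \<forall>x0. \<forall>t\<ge>1.
           integrable M (\<lambda>\<omega>. norm (closed_loop_state A B K (transmission_failure p r \<phi>J) w x0 t \<omega>)) \<and>
           (\<integral>\<omega>. norm (closed_loop_state A B K (transmission_failure p r \<phi>J) w x0 t \<omega>) \<partial>M)
             \<le> \<mu> * \<theta> ^ t * norm x0 + d * w_bar"
proof -
  interpret prob_space M by fact
  note r[measurable] = assms(12) and \<phi>[measurable] = assms(15) and w[measurable] = assms(18)
  define a where "a = induced_norm N A"
  define b where "b = induced_norm N (A + B ** K)"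
  \<comment> \<open>Nothing is known about \<open>p\<close> on negative arguments, where it may fail to be measurable.\<close>
  define q where "q x = p (max 0 x)" for x
  define l where "l = transmission_failure p r \<phi>J"
  \<comment> \<open>\<open>G s t\<close> is the total gain over the steps from \<open>s\<close> to
    \<open>t - 1\<close>.\<close>
  define G where "G s t \<omega> = (\<Prod>i=s..<t. b + (a - b) * of_bool (r i \<omega> \<le> q (\<phi>J i \<omega>)))" for s t \<omega>
  have p_hat01: "0 \<le> p_hat \<phi>_hat" "p_hat \<phi>_hat \<le> 1"
    using assms(10,20) by auto
  have a: "1 < a" and b: "0 \<le> b"
    using unstable_imp_induced_norm_gt_1[OF assms(3,2)] induced_norm_nonneg[OF assms(3)]
    by (simp_all add: a_def b_def)
  have contr: "b + (a - b) * p_hat \<phi>_hat < 1"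
    using assms(24) by (simp add: a_def b_def algebra_simps)
  \<comment> \<open>If \<open>b\<close> exceeded \<open>a > 1\<close>, the convex combination in
    \<open>contr\<close> would exceed 1. The order makes the gain increasing in the failure
    probability.\<close>
  have ba: "b \<le> a"
  proof (rule ccontr)
    assume "\<not> b \<le> a"
    then have "(b - a) * p_hat \<phi>_hat \<le> (b - a) * 1"
      using p_hat01 by (intro mult_left_mono) auto
    with a contr show False by (simp add: algebra_simps)
  qed
  have q_borel[measurable]: "q \<in> borel_measurable borel"
    unfolding q_def by (rule measurable_compose[OF measurable_restrict_space2 assms(4)]) auto
  have q01: "0 \<le> q x" "q x \<le> 1" for x
    using assms(6) unfolding q_def image_subset_iff by (metis atLeastAtMost_iff atLeast_iff max.cobounded1)+
  have l_eq: "l t \<omega> = of_bool (r t \<omega> \<le> q (\<phi>J t \<omega>))" if "\<omega> \<in> space M" for t \<omega>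
    using assms(16)[OF that] by (simp add: l_def transmission_failure_def q_def)
  have l_meas: "l t \<in> borel_measurable M" for t
  proof -
    have "(\<lambda>\<omega>. of_bool (r t \<omega> \<le> q (\<phi>J t \<omega>))) \<in> borel_measurable M"
      unfolding of_bool_def by measurable
    then show ?thesis using l_eq by (subst measurable_cong) auto
  qed
  have [measurable]: "closed_loop_state A B K l w x0 t \<in> borel_measurable M" for x0 t
    by (intro closed_loop_state_measurable l_meas w)
  have [measurable]: "G s t \<in> borel_measurable M" for s t
    unfolding G_def of_bool_def by measurable
  have G_int: "integrable M (G s t)" for s t
  proof (rule integrable_const_bound[where B="a ^ (t - s)"])
    have "\<bar>G s t \<omega>\<bar> \<le> (\<Prod>i=s..<t. a)" for \<omega>
      unfolding G_def abs_prod using a b ba by (intro prod_mono) (auto simp: of_bool_def)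
    then show "AE \<omega> in M. norm (G s t \<omega>) \<le> a ^ (t - s)" by simp
  qed measurable
  obtain c C where cC: "0 < c" "0 < C" "\<And>x. c * norm x \<le> N x" "\<And>x. N x \<le> C * norm x"
    using is_norm_equivalent[OF assms(3)] by blast
  obtain D \<theta> where D: "0 \<le> D" and \<theta>: "0 < \<theta>" "\<theta> < 1"
    and decay: "\<And>(I :: nat set) x. finite I \<Longrightarrow> (\<And>i. i \<in> I \<Longrightarrow> 0 \<le> x i) \<Longrightarrow>
       (\<Sum>i\<in>I. x i) \<le> \<kappa>_hat + \<phi>_hat * real (card I) \<Longrightarrow>
       (\<Prod>i\<in>I. b + (a - b) * p_hat (x i)) \<le> D * \<theta> ^ card I"
    using prod_concave_le_geometric[OF assms(7-10,19,20) b ba contr, where 'i=nat] by blast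
  have G_le: "expectation (G s t) \<le> D * \<theta> ^ (t - s)" for s t
  proof -
    \<comment> \<open>For \<open>t \<le> s\<close> the sum is empty and the bound reduces to
      nonnegativity of \<open>\<kappa>_hat\<close>.\<close>
    have "AE \<omega> in M. (\<Sum>i=s..<t. \<phi>J i \<omega>) \<le> \<kappa>_hat + \<phi>_hat * real (t - s)"
    proof (cases "s < t")
      case True
      then show ?thesis using assms(21)[OF True] by (subst (asm) prob_Collect_eq_1) measurable
    qed (use assms(19) in simp)
    then have le: "AE \<omega> in M. (\<Prod>i=s..<t. b + (a - b) * q (\<phi>J i \<omega>)) \<le> D * \<theta> ^ (t - s)"
      using AE_space
    proof eventually_elim
      case (elim \<omega>)
      have "q (\<phi>J i \<omega>) \<le> p_hat (\<phi>J i \<omega>)" for i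
        using assms(11,16) elim(2) by (simp add: q_def)
      then have "(\<Prod>i=s..<t. b + (a - b) * q (\<phi>J i \<omega>)) \<le> (\<Prod>i=s..<t. b + (a - b) * p_hat (\<phi>J i \<omega>))"
        using b ba q01 by (intro prod_mono conjI add_mono mult_left_mono) auto
      also have "\<dots> \<le> D * \<theta> ^ card {s..<t}"
        using elim assms(16) by (intro decay) auto
      finally show ?case by simp
    qed
    have "b + (a - b) * q x \<le> a" for x
      using mult_left_mono[OF q01(2)[of x], of "a - b"] ba by simp
    then have "\<bar>\<Prod>i=s..<t. b + (a - b) * q (\<phi>J i \<omega>)\<bar> \<le> (\<Prod>i=s..<t. a)" for \<omega>
      unfolding abs_prod using b ba q01 by (intro prod_mono) auto
    then have "integrable M (\<lambda>\<omega>. \<Prod>i=s..<t. b + (a - b) * q (\<phi>J i \<omega>))"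
      by (intro integrable_const_bound[where B="\<Prod>i=s..<t. a"]) auto
    then have "expectation (\<lambda>\<omega>. \<Prod>i=s..<t. b + (a - b) * q (\<phi>J i \<omega>)) \<le> D * \<theta> ^ (t - s)"
      using le by (rule integral_le_const)
    \<comment> \<open>The almost sure bound concerns the product of averaged gains; its expectation
      equals that of the product of random gains.\<close>
    then show ?thesis
      unfolding G_def by (subst expectation_prod_of_bool_le[OF assms(12-15,17) q_borel q01]) auto
  qed
  have "AE \<omega> in M. norm (w t \<omega>) \<le> w_bar" for t
    using assms(23)[of t] by (subst (asm) prob_Collect_eq_1) measurable
  \<comment> \<open>The pathwise estimate needs all times at once; countably many null sets are
    merged into one.\<close>
  then have w_bdd: "AE \<omega> in M. \<forall>t. norm (w t \<omega>) \<le> w_bar"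
    by (simp add: AE_all_countable)
  have main: "integrable M (\<lambda>\<omega>. norm (closed_loop_state A B K l w x0 t \<omega>)) \<and>
    (\<integral>\<omega>. norm (closed_loop_state A B K l w x0 t \<omega>) \<partial>M)
      \<le> C * D / c * \<theta> ^ t * norm x0 + C * D / (c * (1 - \<theta>)) * w_bar" for x0 t
  proof -
    \<comment> \<open>\<open>C\<close> comes from bounding \<open>N x0\<close> and
      \<open>N (w t \<omega>)\<close> by Euclidean norms, \<open>1 / c\<close> from returning from
      \<open>N\<close> to the Euclidean norm of the state. Being integrable, \<open>H\<close> also
      dominates for integrability.\<close>
    define H where "H \<omega> = C / c * (G 0 t \<omega> * norm x0 + w_bar * (\<Sum>s<t. G (Suc s) t \<omega>))" for \<omega>
    have H_int: "integrable M H"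
      unfolding H_def using G_int by auto
    have le_H: "AE \<omega> in M. norm (closed_loop_state A B K l w x0 t \<omega>) \<le> H \<omega>"
      using w_bdd AE_space
    proof eventually_elim
      case (elim \<omega>)
      let ?x = "closed_loop_state A B K l w x0 t \<omega>"
      have W: "N (w t \<omega>) \<le> C * w_bar" for t
        using order_trans[OF cC(4) mult_left_mono[OF elim(1)[rule_format]]] cC(2) by simp
      have G_nonneg: "0 \<le> G s t \<omega>" for s
        unfolding G_def using b ba by (intro prod_nonneg) (auto simp: of_bool_def)
      have "c * norm ?x \<le> N ?x" by (rule cC)
      also have "\<dots> \<le> G 0 t \<omega> * N x0 + C * w_bar * (\<Sum>s<t. G (Suc s) t \<omega>)"
        using closed_loop_state_norm_le[where N=N and w=w and l=l and \<omega>=\<omega> and t=t,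
            OF assms(3) _ W a_def[symmetric] b_def[symmetric]] elim(2)
        by (simp add: l_eq G_def)
      also have "\<dots> \<le> G 0 t \<omega> * (C * norm x0) + C * w_bar * (\<Sum>s<t. G (Suc s) t \<omega>)"
        by (intro add_right_mono mult_left_mono G_nonneg cC)
      finally show ?case using cC(1) by (simp add: H_def field_simps)
    qed
    have int: "integrable M (\<lambda>\<omega>. norm (closed_loop_state A B K l w x0 t \<omega>))"
      by (rule Bochner_Integration.integrable_bound[OF H_int]) (use le_H in auto)
    have "expectation (\<lambda>\<omega>. norm (closed_loop_state A B K l w x0 t \<omega>)) \<le> expectation H"
      by (intro integral_mono_AE int H_int le_H)
    also have "\<dots> = C / c * (expectation (G 0 t) * norm x0 + w_bar * (\<Sum>s<t. expectation (G (Suc s) t)))"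
      unfolding H_def using G_int by simp
    also have "\<dots> \<le> C / c * (D * \<theta> ^ t * norm x0 + w_bar * (D / (1 - \<theta>)))"
    proof (intro mult_left_mono add_mono mult_right_mono)
      show "expectation (G 0 t) \<le> D * \<theta> ^ t" using G_le[of 0 t] by simp
      \<comment> \<open>The tail lengths \<open>t - Suc s\<close> run through 0 to
        \<open>t - 1\<close>, so a partial geometric series arises, bounded independently of
        \<open>t\<close>.\<close>
      have "(\<Sum>s<t. expectation (G (Suc s) t)) \<le> (\<Sum>s<t. D * \<theta> ^ (t - Suc s))"
        by (intro sum_mono G_le)
      also have "\<dots> = D * (\<Sum>j<t. \<theta> ^ j)"
        by (simp add: sum.nat_diff_reindex[of "\<lambda>j. \<theta> ^ j"] flip: sum_distrib_left)
      also have "\<dots> = D * ((1 - \<theta> ^ t) / (1 - \<theta>))"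
        using \<theta> by (simp add: sum_gp_strict)
      also have "\<dots> \<le> D * (1 / (1 - \<theta>))"
        using D \<theta> by (intro mult_left_mono divide_right_mono) auto
      finally show "(\<Sum>s<t. expectation (G (Suc s) t)) \<le> D / (1 - \<theta>)" by simp
    qed (use cC assms(22) in auto)
    also have "\<dots> = C * D / c * \<theta> ^ t * norm x0 + C * D / (c * (1 - \<theta>)) * w_bar"
      using cC(1) \<theta> by (simp add: field_simps)
    finally show ?thesis using int by blast
  qed
  have "0 \<le> C * D / c" "0 \<le> C * D / (c * (1 - \<theta>))" "\<theta> \<in> {0<..<1}"
    using cC D \<theta> by auto
  then show ?thesis
    unfolding l_def[symmetric] using main by blast
qed

end
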